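(* Let $(X,\Sigma_X)$ and $(Y,\Sigma_Y)$ be measurable spaces, $\mu$ a probability measure on $X$, $\mathcal{V}:X\times\Sigma_Y\to[0,1]$ a Markov kernel, and $\mathcal{M}(d\mathbf{q},d\mathbf{v})=\mathcal{V}(\mathbf{q},d\mathbf{v})\,\mu(d\mathbf{q})$. Let $\mathcal{X}=X\times Y$ and suppose there is a measurable mapping $S:\mathcal{X}\to\mathcal{X}$ such that $S\circ S=I$ and $S^*\mathcal{M}$ is absolutely continuous with respect to $\mathcal{M}$. On $\mathcal{X}\times\mathcal{X}$ let $\eta(d\mathbf{u},d\tilde{\mathbf{u}})=\delta_{S(\mathbf{u})}(d\tilde{\mathbf{u}})\,\mathcal{M}(d\mathbf{u})$, $\eta^\perp(d\mathbf{u},d\tilde{\mathbf{u}})=\eta(d\tilde{\mathbf{u}},d\mathbf{u})$, and let $\alpha(\mathbf{u},\tilde{\mathbf{u}})=1\wedge\frac{d\eta^\perp}{d\eta}(\mathbf{u},\tilde{\mathbf{u}})$. Let $\bar P$ be the Markov kernel on $\mathcal{X}$ $$\bar P(\mathbf{u},d\tilde{\mathbf{u}})=\alpha(\mathbf{u},\tilde{\mathbf{u}})\,\delta_{S(\mathbf{u})}(d\tilde{\mathbf{u}})+\delta_{\mathbf{u}}(d\tilde{\mathbf{u}})\,[1-\alpha(\mathbf{u},S(\mathbf{u}))],$$ and define the Markov kernel $P$ on $X$ by $$P(\mathbf{q},A):=\int_Y\bar P((\mathbf{q},\mathbf{v}),A\times Y)\,\mathcal{V}(\mathbf{q},d\mathbf{v})\qquad\text{for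 all }\mathbf{q}\in X,\ A\in\Sigma_X.$$ Then $P$ satisfies detailed balance with respect to $\mu$, i.e. $P(\mathbf{q},d\tilde{\mathbf{q}})\,\mu(d\mathbf{q})=P(\tilde{\mathbf{q}},d\mathbf{q})\,\mu(d\tilde{\mathbf{q}})$ as measures on $X\times X$. Moreover, for $\mu$-a.e. $\mathbf{q}\in X$, $P(\mathbf{q},\cdot)$ coincides with $$\int_Y\hat\alpha(\mathbf{q},\mathbf{v})\,\delta_{\Pi_1\circ S(\mathbf{q},\mathbf{v})}(d\tilde{\mathbf{q}})\,\mathcal{V}(\mathbf{q},d\mathbf{v})+\delta_{\mathbf{q}}(d\tilde{\mathbf{q}})\int_Y(1-\hat\alpha(\mathbf{q},\mathbf{v}))\,\mathcal{V}(\mathbf{q},d\mathbf{v}),\qquad\hat\alpha(\mathbf{q},\mathbf{v})=1\wedge\frac{dS^*\mathcal{M}}{d\mathcal{M}}(\mathbf{q},\mathbf{v}).$$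
   Context: $\Pi_1:X\times Y\to X$ is $\Pi_1(\mathbf{q},\mathbf{v})=\mathbf{q}$. The pushforward of a measure $\nu$ by a measurable map $\phi$ is $\phi^*\nu(A)=\nu(\phi^{-1}(A))$. $a\wedge b=\min(a,b)$; $\delta_x$ is the Dirac measure at $x$; product spaces carry product $\sigma$-algebras. $\eta(d\tilde{\mathbf{u}},d\mathbf{u})$ means the pushforward of $\eta$ under the coordinate swap; under the stated hypotheses $\eta$ and $\eta^\perp$ are mutually absolutely continuous, so $\alpha$ is well defined up to null sets. *)

theory Defs
  imports "HOL-Probability.Probability"
begin

text \<open>
  A Markov kernel from \<open>A\<close> to \<open>B\<close> is an element of \<open>A \<rightarrow>\<^sub>M prob_algebra B\<close>.  For a probability measure
  \<open>m\<close> on \<open>A\<close> and a Markov kernel \<open>K\<close> from \<open>A\<close> to \<open>B\<close>, the following is the measure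
  \<open>K(x, dy) m(dx)\<close> on \<open>A \<times> B\<close>; see \<open>emeasure_semidirect\<close>.
\<close>

definition semidirect ::
    "'a measure \<Rightarrow> 'b measure \<Rightarrow> 'a measure \<Rightarrow> ('a \<Rightarrow> 'b measure) \<Rightarrow> ('a \<times> 'b) measure" where
  "semidirect A B m K = m \<bind> (\<lambda>x. K x \<bind> (\<lambda>y. return (A \<Otimes>\<^sub>M B) (x, y)))"

definition swap_measure :: "'a measure \<Rightarrow> ('a \<times> 'a) measure \<Rightarrow> ('a \<times> 'a) measure" where
  "swap_measure A N = distr N (A \<Otimes>\<^sub>M A) (\<lambda>(x, y). (y, x))"

definition detailed_balance :: "'a measure \<Rightarrow> 'a measure \<Rightarrow> ('a \<Rightarrow> 'a measure) \<Rightarrow> bool" where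
  "detailed_balance A m K \<longleftrightarrow> semidirect A A m K = swap_measure A (semidirect A A m K)"

text \<open>
  Radon-Nikodym derivatives are only determined almost everywhere.  \<open>RN_deriv\<close> selects one of them;
  the next predicate describes all of its measurable versions.
\<close>

definition RN_version :: "'a measure \<Rightarrow> 'a measure \<Rightarrow> ('a \<Rightarrow> ennreal) \<Rightarrow> bool" where
  "RN_version M N f \<longleftrightarrow> f \<in> borel_measurable M \<and> (AE x in M. f x = RN_deriv M N x)"

definition eta :: "'z measure \<Rightarrow> 'z measure \<Rightarrow> ('z \<Rightarrow> 'z) \<Rightarrow> ('z \<times> 'z) measure" where
  "eta Z M S = semidirect Z Z M (\<lambda>u. return Z (S u))"

definition eta_perp :: "'z measure \<Rightarrow> 'z measure \<Rightarrow> ('z \<Rightarrow> 'z) \<Rightarrow> ('z \<times> 'z) measure" where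
  "eta_perp Z M S = swap_measure Z (eta Z M S)"

text \<open>
  \<open>\<alpha>(u, w) \<delta>\<^bsub>S(u)\<^esub>(dw) + \<delta>\<^bsub>u\<^esub>(dw) [1 - \<alpha>(u, S(u))]\<close>; the truncated subtraction of \<open>ennreal\<close> is harmless
  because \<open>\<alpha> \<le> 1\<close> in all uses.  That this and \<open>marginal_kernel\<close> are Markov kernels is shown in
  \<open>Pbar_markov_kernel\<close> and \<open>marginal_kernel_markov_kernel\<close>.
\<close>

definition Pbar :: "'z measure \<Rightarrow> ('z \<Rightarrow> 'z) \<Rightarrow> ('z \<times> 'z \<Rightarrow> ennreal) \<Rightarrow> 'z \<Rightarrow> 'z measure" where
  "Pbar Z S \<alpha> u = measure_of (space Z) (sets Z)
     (\<lambda>C. emeasure (density (return Z (S u)) (\<lambda>w. \<alpha> (u, w))) C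
          + emeasure (return Z u) C * (1 - \<alpha> (u, S u)))"

definition marginal_kernel ::
    "'q measure \<Rightarrow> 'v measure \<Rightarrow> ('q \<Rightarrow> 'v measure) \<Rightarrow> ('q \<times> 'v \<Rightarrow> ('q \<times> 'v) measure) \<Rightarrow> 'q \<Rightarrow> 'q measure"
  where
  "marginal_kernel X Y V K q = measure_of (space X) (sets X)
     (\<lambda>A. \<integral>\<^sup>+ v. emeasure (K (q, v)) (A \<times> space Y) \<partial>V q)"


subsection \<open>Well-definedness\<close>

lemma semidirect_inner_kernel:
  assumes "K \<in> A \<rightarrow>\<^sub>M prob_algebra B"
  shows "(\<lambda>x. K x \<bind> (\<lambda>y. return (A \<Otimes>\<^sub>M B) (x, y))) \<in> A \<rightarrow>\<^sub>M prob_algebra (A \<Otimes>\<^sub>M B)"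
  using assms by measurable

lemma emeasure_semidirect:
  assumes m: "m \<in> space (prob_algebra A)" and K: "K \<in> A \<rightarrow>\<^sub>M prob_algebra B"
    and C[measurable]: "C \<in> sets (A \<Otimes>\<^sub>M B)"
  shows "emeasure (semidirect A B m K) C = (\<integral>\<^sup>+ x. \<integral>\<^sup>+ y. indicator C (x, y) \<partial>K x \<partial>m)"
proof -
  have ms[measurable_cong]: "sets m = sets A" and "prob_space m"
    using m by (auto simp: space_prob_algebra)
  then interpret m: prob_space m by simp
  have sm: "space m = space A" using ms by (rule sets_eq_imp_space_eq)
  have K': "K \<in> m \<rightarrow>\<^sub>M subprob_algebra B"
    using measurable_prob_algebraD[OF K] by simp
  have G: "(\<lambda>x. K x \<bind> (\<lambda>y. return (A \<Otimes>\<^sub>M B) (x, y))) \<in> m \<rightarrow>\<^sub>M subprob_algebra (A \<Otimes>\<^sub>M B)"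
    using measurable_prob_algebraD[OF semidirect_inner_kernel[OF K]] by simp
  have "emeasure (K x \<bind> (\<lambda>y. return (A \<Otimes>\<^sub>M B) (x, y))) C = (\<integral>\<^sup>+ y. indicator C (x, y) \<partial>K x)"
    if x: "x \<in> space m" for x
  proof -
    have s[measurable_cong]: "sets (K x) = sets B"
      using measurable_space[OF K'] x by (auto simp: space_subprob_algebra)
    have xA[simp]: "x \<in> space A" using x sm by simp
    have ne: "space (K x) \<noteq> {}"
      using measurable_space[OF K'] x by (auto simp: space_subprob_algebra dest: subprob_space.subprob_not_empty)
    show ?thesis
      by (subst emeasure_bind[OF ne, where N = "A \<Otimes>\<^sub>M B"]) (auto intro!: nn_integral_cong)
  qed
  then show ?thesis
    unfolding semidirect_def
    by (subst emeasure_bind[OF m.not_empty G C]) (auto intro!: nn_integral_cong)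
qed

lemma semidirect_prob_algebra:
  assumes m: "m \<in> space (prob_algebra A)" and K: "K \<in> A \<rightarrow>\<^sub>M prob_algebra B"
  shows "semidirect A B m K \<in> space (prob_algebra (A \<Otimes>\<^sub>M B))"
proof -
  have "(\<lambda>_. m \<bind> (\<lambda>x. K x \<bind> (\<lambda>y. return (A \<Otimes>\<^sub>M B) (x, y)))) \<in> count_space {()} \<rightarrow>\<^sub>M prob_algebra (A \<Otimes>\<^sub>M B)"
    using m by (intro measurable_bind_prob_space[OF _ semidirect_inner_kernel[OF K]]) simp
  from measurable_space[OF this] show ?thesis
    by (simp add: semidirect_def)
qed

lemma eta_eq_distr:
  assumes M: "M \<in> space (prob_algebra Z)" and S[measurable]: "S \<in> Z \<rightarrow>\<^sub>M Z"
  shows "eta Z M S = distr M (Z \<Otimes>\<^sub>M Z) (\<lambda>u. (u, S u))"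
proof -
  have ms[measurable_cong]: "sets M = sets Z" and "prob_space M"
    using M by (auto simp: space_prob_algebra)
  then interpret M: prob_space M by simp
  have sm: "space M = space Z" using ms by (rule sets_eq_imp_space_eq)
  have "eta Z M S = M \<bind> (\<lambda>u. return (Z \<Otimes>\<^sub>M Z) (u, S u))"
    unfolding eta_def semidirect_def
  proof (intro bind_cong refl)
    fix u assume "u \<in> space M"
    then have [simp]: "u \<in> space Z" "S u \<in> space Z" using sm measurable_space[OF S] by auto
    show "return Z (S u) \<bind> (\<lambda>y. return (Z \<Otimes>\<^sub>M Z) (u, y)) = return (Z \<Otimes>\<^sub>M Z) (u, S u)"
      by (rule bind_return[where N = "Z \<Otimes>\<^sub>M Z"]) auto
  qed
  also have "\<dots> = distr M (Z \<Otimes>\<^sub>M Z) (\<lambda>u. (u, S u))"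
    by (rule bind_return_distr'[OF M.not_empty]) measurable
  finally show ?thesis .
qed

lemma sets_eta:
  assumes "M \<in> space (prob_algebra Z)" "S \<in> Z \<rightarrow>\<^sub>M Z"
  shows "sets (eta Z M S) = sets (Z \<Otimes>\<^sub>M Z)"
  using assms by (simp add: eta_eq_distr)

text \<open>
  Under the hypotheses on \<open>S\<close>, the measures \<open>eta\<close> and \<open>eta_perp\<close> are mutually absolutely continuous,
  so the versions in the sense of \<open>RN_version\<close> are exactly the densities of \<open>eta_perp\<close> with respect to \<open>eta\<close>.
\<close>

lemma eta_mutually_absolutely_continuous:
  assumes M: "M \<in> space (prob_algebra Z)" and S[measurable]: "S \<in> Z \<rightarrow>\<^sub>M Z"
    and inv: "\<And>u. u \<in> space Z \<Longrightarrow> S (S u) = u"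
    and ac: "absolutely_continuous M (distr M Z S)"
  shows "absolutely_continuous (eta Z M S) (eta_perp Z M S)"
    and "absolutely_continuous (eta_perp Z M S) (eta Z M S)"
proof -
  have ms[measurable_cong]: "sets M = sets Z" using M by (auto simp: space_prob_algebra)
  have sm: "space M = space Z" using ms by (rule sets_eq_imp_space_eq)
  have SS: "S u \<in> space Z" if "u \<in> space Z" for u using measurable_space[OF S that] .
  have e: "eta Z M S = distr M (Z \<Otimes>\<^sub>M Z) (\<lambda>u. (u, S u))"
    by (rule eta_eq_distr[OF M S])
  have p: "eta_perp Z M S = distr M (Z \<Otimes>\<^sub>M Z) (\<lambda>u. (S u, u))"
    unfolding eta_perp_def swap_measure_def e by (subst distr_distr) (auto simp: comp_def)
  have null: "S -` B \<inter> space Z \<in> null_sets M" if "B \<in> null_sets M" for B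
  proof -
    have "B \<in> null_sets (distr M Z S)" using that ac by (auto simp: absolutely_continuous_def)
    then show ?thesis by (subst (asm) null_sets_distr_iff) (auto simp: sm)
  qed
  have eq1: "(\<lambda>u. (S u, u)) -` C \<inter> space Z = S -` ((\<lambda>u. (u, S u)) -` C \<inter> space Z) \<inter> space Z" for C
    using SS inv by auto
  have eq2: "(\<lambda>u. (u, S u)) -` C \<inter> space Z = S -` ((\<lambda>u. (S u, u)) -` C \<inter> space Z) \<inter> space Z" for C
    using SS inv by auto
  show "absolutely_continuous (eta Z M S) (eta_perp Z M S)"
    unfolding absolutely_continuous_def e p
    using null[of "(\<lambda>u. (u, S u)) -` C \<inter> space Z" for C, folded eq1] by (auto simp: null_sets_distr_iff sm)
  show "absolutely_continuous (eta_perp Z M S) (eta Z M S)"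
    unfolding absolutely_continuous_def e p
    using null[of "(\<lambda>u. (S u, u)) -` C \<inter> space Z" for C, folded eq2] by (auto simp: null_sets_distr_iff sm)
qed

lemma RN_version_density:
  assumes "sigma_finite_measure M" "absolutely_continuous M N" "sets N = sets M" "RN_version M N f"
  shows "density M f = N"
proof -
  have "density M f = density M (RN_deriv M N)"
    using assms(4) by (intro density_cong) (auto simp: RN_version_def)
  then show ?thesis
    using sigma_finite_measure.density_RN_deriv[OF assms(1-3)] by simp
qed

lemma space_Pbar [simp]: "space (Pbar Z S \<alpha> u) = space Z"
  and sets_Pbar [simp, measurable_cong]: "sets (Pbar Z S \<alpha> u) = sets Z"
  by (simp_all add: Pbar_def)

lemma emeasure_Pbar:
  assumes C: "C \<in> sets Z"
  shows "emeasure (Pbar Z S \<alpha> u) C =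
    emeasure (density (return Z (S u)) (\<lambda>w. \<alpha> (u, w))) C + emeasure (return Z u) C * (1 - \<alpha> (u, S u))"
    (is "_ = ?f C")
proof (rule emeasure_measure_of[OF Pbar_def])
  show "countably_additive (sets (Pbar Z S \<alpha> u)) ?f"
  proof (rule countably_additiveI)
    fix F :: "nat \<Rightarrow> _" assume F: "range F \<subseteq> sets (Pbar Z S \<alpha> u)" "disjoint_family F"
    have "(\<Sum>i. ?f (F i)) = (\<Sum>i. emeasure (density (return Z (S u)) (\<lambda>w. \<alpha> (u, w))) (F i))
        + (\<Sum>i. emeasure (return Z u) (F i)) * (1 - \<alpha> (u, S u))"
      by (simp add: suminf_add[symmetric] flip: ennreal_suminf_multc)
    also have "\<dots> = ?f (\<Union>i. F i)"
      using F by (subst (1 2) suminf_emeasure) auto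
    finally show "(\<Sum>i. ?f (F i)) = ?f (\<Union>i. F i)" .
  qed
qed (use C sets.space_closed in \<open>auto simp: positive_def\<close>)

lemma Pbar_markov_kernel:
  assumes S[measurable]: "S \<in> Z \<rightarrow>\<^sub>M Z"
    and \<alpha>[measurable]: "\<alpha> \<in> borel_measurable (Z \<Otimes>\<^sub>M Z)" and le: "\<And>z. \<alpha> z \<le> 1"
  shows "Pbar Z S \<alpha> \<in> Z \<rightarrow>\<^sub>M prob_algebra Z"
proof -
  have eq: "emeasure (Pbar Z S \<alpha> u) C = \<alpha> (u, S u) * indicator C (S u) + indicator C u * (1 - \<alpha> (u, S u))"
    if u: "u \<in> space Z" and C[measurable]: "C \<in> sets Z" for u C
  proof -
    have [simp]: "S u \<in> space Z" using u measurable_space[OF S] by auto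
    show ?thesis
      using u C by (simp add: emeasure_Pbar emeasure_density nn_integral_return)
  qed
  have prob: "prob_space (Pbar Z S \<alpha> u)" if u: "u \<in> space Z" for u
  proof
    have "S u \<in> space Z" using u measurable_space[OF S] by auto
    then show "emeasure (Pbar Z S \<alpha> u) (space (Pbar Z S \<alpha> u)) = 1"
      using u le[of "(u, S u)"] by (simp add: eq add_diff_inverse_ennreal)
  qed
  show ?thesis
  proof (intro measurable_prob_algebraI measurable_subprob_algebra)
    fix C assume C[measurable]: "C \<in> sets Z"
    show "(\<lambda>u. emeasure (Pbar Z S \<alpha> u) C) \<in> borel_measurable Z"
      by (subst measurable_cong[OF eq[OF _ C]]) measurable
  qed (auto intro: prob prob_space_imp_subprob_space)
qed

lemma sets_marginal_kernel [simp]: "sets (marginal_kernel X Y V K q) = sets X"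
  by (simp add: marginal_kernel_def)

lemma emeasure_marginal_kernel:
  assumes V: "V \<in> X \<rightarrow>\<^sub>M prob_algebra Y"
    and K: "K \<in> X \<Otimes>\<^sub>M Y \<rightarrow>\<^sub>M prob_algebra (X \<Otimes>\<^sub>M Y)" and q: "q \<in> space X" and A: "A \<in> sets X"
  shows "emeasure (marginal_kernel X Y V K q) A = (\<integral>\<^sup>+ v. emeasure (K (q, v)) (A \<times> space Y) \<partial>V q)"
proof -
  let ?P = "marginal_kernel X Y V K q" and ?f = "\<lambda>A. \<integral>\<^sup>+ v. emeasure (K (q, v)) (A \<times> space Y) \<partial>V q"
  have Vq: "sets (V q) = sets Y" using measurable_space[OF V q] by (auto simp: space_prob_algebra)
  have Kq: "(\<lambda>v. K (q, v)) \<in> V q \<rightarrow>\<^sub>M subprob_algebra (X \<Otimes>\<^sub>M Y)"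
    using measurable_compose[OF measurable_Pair1'[OF q] measurable_prob_algebraD[OF K]] Vq
    by (simp cong: measurable_cong_sets)
  show ?thesis
  proof (rule emeasure_measure_of[OF marginal_kernel_def])
    show "countably_additive (sets ?P) ?f"
    proof (rule countably_additiveI)
      fix F :: "nat \<Rightarrow> _" assume F: "range F \<subseteq> sets ?P" "disjoint_family F"
      have FX: "F i \<in> sets X" for i using F(1) by auto
      have "(\<Sum>i. ?f (F i)) = (\<integral>\<^sup>+ v. (\<Sum>i. emeasure (K (q, v)) (F i \<times> space Y)) \<partial>V q)"
        using measurable_compose[OF Kq measurable_emeasure_subprob_algebra] FX
        by (intro nn_integral_suminf[symmetric]) auto
      also have "\<dots> = ?f (\<Union>i. F i)"
      proof (rule nn_integral_cong)
        fix v assume "v \<in> space (V q)"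
        then have "sets (K (q, v)) = sets (X \<Otimes>\<^sub>M Y)"
          using measurable_space[OF Kq] by (auto simp: space_subprob_algebra)
        moreover have "(\<Union>i. F i) \<times> space Y = (\<Union>i. F i \<times> space Y)" by auto
        ultimately show "(\<Sum>i. emeasure (K (q, v)) (F i \<times> space Y)) = emeasure (K (q, v)) ((\<Union>i. F i) \<times> space Y)"
          using F(2) FX by (subst suminf_emeasure) (auto simp: disjoint_family_on_def disjoint_iff)
      qed
      finally show "(\<Sum>i. ?f (F i)) = ?f (\<Union>i. F i)" .
    qed
  qed (use A sets.space_closed in \<open>auto simp: positive_def\<close>)
qed

lemma marginal_kernel_eq_distr:
  assumes V: "V \<in> X \<rightarrow>\<^sub>M prob_algebra Y"
    and K: "K \<in> X \<Otimes>\<^sub>M Y \<rightarrow>\<^sub>M prob_algebra (X \<Otimes>\<^sub>M Y)" and q: "q \<in> space X"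
  shows "marginal_kernel X Y V K q = distr (V q \<bind> (\<lambda>v. K (q, v))) X fst"
proof -
  have Vq: "sets (V q) = sets Y" "prob_space (V q)"
    using measurable_space[OF V q] by (auto simp: space_prob_algebra)
  have ne: "space (V q) \<noteq> {}" using Vq(2) by (rule prob_space.not_empty)
  have Kq: "(\<lambda>v. K (q, v)) \<in> V q \<rightarrow>\<^sub>M subprob_algebra (X \<Otimes>\<^sub>M Y)"
    using measurable_compose[OF measurable_Pair1'[OF q] measurable_prob_algebraD[OF K]] Vq(1)
    by (simp cong: measurable_cong_sets)
  have sK: "sets (K (q, v)) = sets (X \<Otimes>\<^sub>M Y)" if "v \<in> space (V q)" for v
    using measurable_space[OF Kq that] by (auto simp: space_subprob_algebra)
  have sb: "sets (V q \<bind> (\<lambda>v. K (q, v))) = sets (X \<Otimes>\<^sub>M Y)"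
    using sK ne by (rule sets_bind)
  then have fstm: "fst \<in> (V q \<bind> (\<lambda>v. K (q, v))) \<rightarrow>\<^sub>M X"
    by (simp cong: measurable_cong_sets)
  show ?thesis
  proof (rule measure_eqI)
    fix A assume "A \<in> sets (marginal_kernel X Y V K q)"
    then have A: "A \<in> sets X" by simp
    have "fst -` A \<inter> space (V q \<bind> (\<lambda>v. K (q, v))) = A \<times> space Y"
      using sets.sets_into_space[OF A] sets_eq_imp_space_eq[OF sb] by (auto simp: space_pair_measure)
    then show "emeasure (marginal_kernel X Y V K q) A = emeasure (distr (V q \<bind> (\<lambda>v. K (q, v))) X fst) A"
      using A by (simp add: emeasure_marginal_kernel[OF V K q] emeasure_distr[OF fstm] emeasure_bind[OF ne Kq])
  qed simp
qed

lemma marginal_kernel_markov_kernel: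
  assumes V: "V \<in> X \<rightarrow>\<^sub>M prob_algebra Y"
    and K: "K \<in> X \<Otimes>\<^sub>M Y \<rightarrow>\<^sub>M prob_algebra (X \<Otimes>\<^sub>M Y)"
  shows "marginal_kernel X Y V K \<in> X \<rightarrow>\<^sub>M prob_algebra X"
proof -
  have "(\<lambda>q. distr (V q \<bind> (\<lambda>v. K (q, v))) X fst) \<in> X \<rightarrow>\<^sub>M prob_algebra X"
    using V K by measurable
  then show ?thesis
    by (subst measurable_cong[OF marginal_kernel_eq_distr[OF V K]])
qed

end

theory Submission
  imports Defs
begin

text \<open>
  Since \<open>\<eta>\<close> is the image of \<open>M\<close> under \<open>u \<mapsto> (u, S u)\<close>, the density \<open>d\<eta>\<^sup>\<bottom>/d\<eta>\<close> on the graph of \<open>S\<close> is the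
  density \<open>s\<close> of \<open>S\<^sup>*M\<close> with respect to \<open>M\<close>.  Because \<open>S\<close> is an involution, \<open>s(u) s(S u) = 1\<close> almost everywhere, so
  that \<open>min 1 (s(S u)) s(u) = min 1 (s(u))\<close>; hence the measure \<open>min 1 s dM\<close> is invariant under \<open>S\<close>.  The
  accepted part of \<open>P(q, dq') \<mu>(dq)\<close> is the image of this measure under \<open>u \<mapsto> (\<Pi>\<^sub>1 u, \<Pi>\<^sub>1 (S u))\<close>, and
  the rejected part is carried by the diagonal, so both are symmetric.
\<close>

section \<open>Integrals, null sets and uniqueness for measures on products\<close>

lemma nn_integral_semidirect:
  assumes m: "m \<in> space (prob_algebra A)" and K: "K \<in> A \<rightarrow>\<^sub>M prob_algebra B"
    and f[measurable]: "f \<in> borel_measurable (A \<Otimes>\<^sub>M B)"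
  shows "(\<integral>\<^sup>+ z. f z \<partial>semidirect A B m K) = (\<integral>\<^sup>+ x. \<integral>\<^sup>+ y. f (x, y) \<partial>K x \<partial>m)"
proof -
  have ms[measurable_cong]: "sets m = sets A"
    using m by (auto simp: space_prob_algebra)
  have sm: "space m = space A" using ms by (rule sets_eq_imp_space_eq)
  have G: "(\<lambda>x. K x \<bind> (\<lambda>y. return (A \<Otimes>\<^sub>M B) (x, y))) \<in> m \<rightarrow>\<^sub>M subprob_algebra (A \<Otimes>\<^sub>M B)"
    using measurable_prob_algebraD[OF semidirect_inner_kernel[OF K]] by simp
  have "(\<integral>\<^sup>+ z. f z \<partial>(K x \<bind> (\<lambda>y. return (A \<Otimes>\<^sub>M B) (x, y)))) = (\<integral>\<^sup>+ y. f (x, y) \<partial>K x)"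
    if "x \<in> space m" for x
  proof -
    have x[simp]: "x \<in> space A" using that sm by simp
    have s[measurable_cong]: "sets (K x) = sets B"
      using measurable_space[OF K x] by (auto simp: space_prob_algebra)
    show ?thesis
      by (subst nn_integral_bind[where B = "A \<Otimes>\<^sub>M B"])
        (auto intro!: nn_integral_cong nn_integral_return simp: space_pair_measure sets_eq_imp_space_eq[OF s])
  qed
  then show ?thesis
    unfolding semidirect_def by (subst nn_integral_bind[OF f G]) (auto intro!: nn_integral_cong)
qed

text \<open>The exceptional set lies in a measurable null set \<open>N\<close>. The iterated
  integral of the indicator of \<open>N\<close> vanishes, so almost every section of
  \<open>N\<close> is null for \<open>K x\<close>. This carries statements that hold almost
  everywhere for \<open>M\<close> to almost every fibre \<open>V q\<close>.\<close>

lemma AE_semidirect: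
  assumes m: "m \<in> space (prob_algebra A)" and K: "K \<in> A \<rightarrow>\<^sub>M prob_algebra B"
    and ae: "AE z in semidirect A B m K. Q z"
  shows "AE x in m. AE y in K x. Q (x, y)"
proof -
  have ms[measurable_cong]: "sets m = sets A"
    using m by (auto simp: space_prob_algebra)
  have sm: "space m = space A" using ms by (rule sets_eq_imp_space_eq)
  have K'[measurable]: "K \<in> A \<rightarrow>\<^sub>M subprob_algebra B"
    using measurable_prob_algebraD[OF K] .
  have sD: "sets (semidirect A B m K) = sets (A \<Otimes>\<^sub>M B)"
    using semidirect_prob_algebra[OF m K] by (auto simp: space_prob_algebra)
  from AE_E[OF ae] obtain N where
    N: "{z \<in> space (semidirect A B m K). \<not> Q z} \<subseteq> N" "emeasure (semidirect A B m K) N = 0"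
      "N \<in> sets (semidirect A B m K)" by blast
  have Nm[measurable]: "N \<in> sets (A \<Otimes>\<^sub>M B)" using N(3) sD by simp
  have NQ: "Q z" if "z \<in> space (A \<Otimes>\<^sub>M B)" "z \<notin> N" for z
    using N(1) that sets_eq_imp_space_eq[OF sD] by auto
  have "(\<lambda>x. \<integral>\<^sup>+ y. indicator N (x, y) \<partial>K x) \<in> borel_measurable m"
    unfolding measurable_cong_sets[OF ms refl]
    by (rule nn_integral_measurable_subprob_algebra2[OF _ K']) measurable
  moreover have "(\<integral>\<^sup>+ x. \<integral>\<^sup>+ y. indicator N (x, y) \<partial>K x \<partial>m) = 0"
    using N(2) emeasure_semidirect[OF m K Nm] by simp
  ultimately have "AE x in m. (\<integral>\<^sup>+ y. indicator N (x, y) \<partial>K x) = 0"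
    by (subst (asm) nn_integral_0_iff_AE)
  then show ?thesis
  proof (rule AE_mp[OF _ AE_I2[OF impI]])
    fix x assume x: "x \<in> space m" and 0: "(\<integral>\<^sup>+ y. indicator N (x, y) \<partial>K x) = 0"
    have xA[simp]: "x \<in> space A" using x sm by simp
    have s[measurable_cong]: "sets (K x) = sets B"
      using measurable_space[OF K xA] by (auto simp: space_prob_algebra)
    from 0 have "AE y in K x. indicator N (x, y) = (0::ennreal)"
      by (subst (asm) nn_integral_0_iff_AE) auto
    then show "AE y in K x. Q (x, y)"
      by (rule AE_mp, intro AE_I2 impI)
        (auto intro!: NQ simp: space_pair_measure sets_eq_imp_space_eq[OF s] indicator_def split: if_splits)
  qed
qed

text \<open>Rectangles form an intersection-stable generator that contains the whole space, and the
  whole space has finite measure. Detailed balance therefore only has to be checked on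
  rectangles.\<close>

lemma measure_eqI_rectangles:
  assumes M: "finite_measure M" "sets M = sets (A \<Otimes>\<^sub>M B)" and N: "sets N = sets (A \<Otimes>\<^sub>M B)"
    and eq: "\<And>a b. a \<in> sets A \<Longrightarrow> b \<in> sets B \<Longrightarrow> emeasure M (a \<times> b) = emeasure N (a \<times> b)"
  shows "M = N"
proof (rule measure_eqI_generator_eq[OF Int_stable_pair_measure_generator pair_measure_closed])
  show "range (\<lambda>_::nat. space A \<times> space B) \<subseteq> {a \<times> b |a b. a \<in> sets A \<and> b \<in> sets B}"
    by auto
  show "emeasure M (space A \<times> space B) \<noteq> \<infinity>"
    using finite_measure.emeasure_finite[OF M(1)] by simp
qed (use M N eq in \<open>auto simp: sets_pair_measure\<close>)

section \<open>Change of variables under the involution\<close>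

text \<open>Both sides integrate \<open>f\<close> against the image of \<open>M\<close> under
  \<open>S\<close>, once as a pushforward and once through its density \<open>s\<close>.\<close>

lemma involution_density_nn_integral:
  assumes ms[measurable_cong]: "sets M = sets Z" and S[measurable]: "S \<in> Z \<rightarrow>\<^sub>M Z"
    and s[measurable]: "s \<in> borel_measurable Z" and d: "density M s = distr M Z S"
    and f[measurable]: "f \<in> borel_measurable Z"
  shows "(\<integral>\<^sup>+ u. f (S u) \<partial>M) = (\<integral>\<^sup>+ u. s u * f u \<partial>M)"
proof -
  have "(\<integral>\<^sup>+ u. f (S u) \<partial>M) = (\<integral>\<^sup>+ u. f u \<partial>distr M Z S)"
    by (subst nn_integral_distr) auto
  also have "\<dots> = (\<integral>\<^sup>+ u. s u * f u \<partial>M)"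
    unfolding d[symmetric] by (subst nn_integral_density) auto
  finally show ?thesis .
qed

text \<open>Changing variables twice returns to \<open>M\<close>, because \<open>S\<close> is its
  own inverse. Hence \<open>s u * s (S u)\<close> is a density of \<open>M\<close> with respect to
  itself, and densities are unique almost everywhere.\<close>

lemma involution_density_mult_eq_1:
  assumes "finite_measure M"
    and ms[measurable_cong]: "sets M = sets Z" and S[measurable]: "S \<in> Z \<rightarrow>\<^sub>M Z"
    and inv: "\<And>u. u \<in> space Z \<Longrightarrow> S (S u) = u"
    and s[measurable]: "s \<in> borel_measurable Z" and d: "density M s = distr M Z S"
  shows "AE u in M. s u * s (S u) = 1"
proof -
  interpret finite_measure M by fact
  have sm: "space M = space Z" using ms by (rule sets_eq_imp_space_eq)
  note change = involution_density_nn_integral[OF ms S s d]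
  have "density M (\<lambda>u. s u * s (S u)) = density M (\<lambda>_. 1)"
  proof (rule measure_eqI)
    fix C assume "C \<in> sets (density M (\<lambda>u. s u * s (S u)))"
    then have C[measurable]: "C \<in> sets Z" using ms by simp
    have "(\<integral>\<^sup>+ u. s u * s (S u) * indicator C u \<partial>M) = (\<integral>\<^sup>+ u. s u * (s (S u) * indicator C u) \<partial>M)"
      by (simp add: mult.assoc)
    \<comment> \<open>The change of variables is read from right to left with
      \<open>f u = s (S u) * indicator C u\<close>. Cancelling \<open>S (S u)\<close> leaves
      \<open>s u\<close> as a weight, so the same rule applies once more.\<close>
    also have "\<dots> = (\<integral>\<^sup>+ u. s (S (S u)) * indicator C (S u) \<partial>M)"
      by (subst change[symmetric]) auto
    also have "\<dots> = (\<integral>\<^sup>+ u. s u * indicator C (S u) \<partial>M)"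
      by (intro nn_integral_cong) (simp add: inv sm)
    also have "\<dots> = (\<integral>\<^sup>+ u. indicator C (S (S u)) \<partial>M)"
      by (subst change[symmetric]) auto
    also have "\<dots> = (\<integral>\<^sup>+ u. indicator C u \<partial>M)"
      by (intro nn_integral_cong) (simp add: inv sm)
    finally show "emeasure (density M (\<lambda>u. s u * s (S u))) C = emeasure (density M (\<lambda>_. 1)) C"
      by (simp add: emeasure_density)
  qed simp
  then show ?thesis
    by (subst (asm) density_unique_iff) auto
qed

lemma involution_acceptance_symmetric:
  assumes "finite_measure M"
    and ms[measurable_cong]: "sets M = sets Z" and S[measurable]: "S \<in> Z \<rightarrow>\<^sub>M Z"
    and inv: "\<And>u. u \<in> space Z \<Longrightarrow> S (S u) = u"
    and s[measurable]: "s \<in> borel_measurable Z" and d: "density M s = distr M Z S"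
    and f[measurable]: "f \<in> borel_measurable Z"
  shows "(\<integral>\<^sup>+ u. min 1 (s u) * f (S u) \<partial>M) = (\<integral>\<^sup>+ u. min 1 (s u) * f u \<partial>M)"
proof -
  have sm: "space M = space Z" using ms by (rule sets_eq_imp_space_eq)
  \<comment> \<open>Monotonicity of multiplication gives this for infinite values as well. It is
    applied with \<open>b = s u\<close> and \<open>a = s (S u)\<close>, whose product is 1 almost
    everywhere.\<close>
  have min_mult: "b * min 1 a = min b (b * a)" for a b :: ennreal
    by (cases "1 \<le> a") (use mult_left_mono[of a 1 b] mult_left_mono[of 1 a b] in \<open>auto simp: min_def intro: antisym\<close>)
  \<comment> \<open>Replacing \<open>s u\<close> by \<open>s (S (S u))\<close> makes the whole
    integrand a function of \<open>S u\<close>, the form required by the change of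
    variables.\<close>
  have "(\<integral>\<^sup>+ u. min 1 (s u) * f (S u) \<partial>M) = (\<integral>\<^sup>+ u. min 1 (s (S (S u))) * f (S u) \<partial>M)"
    by (intro nn_integral_cong) (simp add: inv sm)
  also have "\<dots> = (\<integral>\<^sup>+ u. s u * (min 1 (s (S u)) * f u) \<partial>M)"
    by (rule involution_density_nn_integral[OF ms S s d]) measurable
  also have "\<dots> = (\<integral>\<^sup>+ u. min 1 (s u) * f u \<partial>M)"
  proof (rule nn_integral_cong_AE)
    have "AE u in M. s u * s (S u) = 1"
      by (rule involution_density_mult_eq_1[OF assms(1-6)])
    then show "AE u in M. s u * (min 1 (s (S u)) * f u) = min 1 (s u) * f u"
      by eventually_elim (simp add: mult.assoc[symmetric] min_mult min.commute)
  qed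
  finally show ?thesis .
qed

section \<open>The density of \<open>eta_perp\<close> along the graph of \<open>S\<close>\<close>

text \<open>Restricted to the graph, \<open>r\<close> is a density of the image of \<open>M\<close>
  under \<open>S\<close>, just as \<open>s\<close> is, so uniqueness of densities applies. This
  identifies the acceptance probability in \<open>Pbar\<close> with the one in the explicit
  formula.\<close>

lemma RN_deriv_eta_on_graph:
  assumes M: "M \<in> space (prob_algebra Z)" and S[measurable]: "S \<in> Z \<rightarrow>\<^sub>M Z"
    and inv: "\<And>u. u \<in> space Z \<Longrightarrow> S (S u) = u"
    and ac: "absolutely_continuous M (distr M Z S)"
    and r: "RN_version (eta Z M S) (eta_perp Z M S) r"
    and s: "RN_version M (distr M Z S) s"
  shows "AE u in M. r (u, S u) = s u"
proof -
  have ms[measurable_cong]: "sets M = sets Z" and "prob_space M"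
    using M by (auto simp: space_prob_algebra)
  then interpret M: prob_space M by simp
  have sm: "space M = space Z" using ms by (rule sets_eq_imp_space_eq)
  have SS[simp]: "S u \<in> space Z" if "u \<in> space Z" for u using measurable_space[OF S that] .
  have e: "eta Z M S = distr M (Z \<Otimes>\<^sub>M Z) (\<lambda>u. (u, S u))"
    by (rule eta_eq_distr[OF M S])
  have p: "eta_perp Z M S = distr M (Z \<Otimes>\<^sub>M Z) (\<lambda>u. (S u, u))"
    unfolding eta_perp_def swap_measure_def e by (subst distr_distr) (auto simp: comp_def)
  have rm[measurable]: "r \<in> borel_measurable (Z \<Otimes>\<^sub>M Z)"
    using r by (simp add: RN_version_def e)
  have smm[measurable]: "s \<in> borel_measurable Z"
    using s ms by (simp add: RN_version_def cong: measurable_cong_sets)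
  have "prob_space (eta Z M S)"
    unfolding e by (rule M.prob_space_distr) measurable
  then have sf: "sigma_finite_measure (eta Z M S)"
    by (simp add: prob_space_imp_sigma_finite)
  have dr: "density (eta Z M S) r = eta_perp Z M S"
    by (rule RN_version_density[OF sf eta_mutually_absolutely_continuous(1)[OF M S inv ac] _ r])
      (simp_all add: e p)
  have ds: "density M s = distr M Z S"
    by (rule RN_version_density[OF M.sigma_finite_measure_axioms ac _ s]) (simp add: ms)
  have "density M (\<lambda>u. r (u, S u)) = density M s"
  proof (rule measure_eqI)
    fix C assume "C \<in> sets (density M (\<lambda>u. r (u, S u)))"
    then have C[measurable]: "C \<in> sets Z" using ms by simp
    have CZ: "C \<subseteq> space Z" using sets.sets_into_space[OF C] .
    \<comment> \<open>The cylinder \<open>C \<times> space Z\<close> tests only the first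
      coordinate, which is \<open>u\<close> under \<open>eta\<close> and \<open>S u\<close> under
      \<open>eta_perp\<close>.\<close>
    have "emeasure (density M (\<lambda>u. r (u, S u))) C = (\<integral>\<^sup>+ u. r (u, S u) * indicator (C \<times> space Z) (u, S u) \<partial>M)"
      by (subst emeasure_density) (auto intro!: nn_integral_cong simp: sm indicator_def)
    also have "\<dots> = emeasure (density (eta Z M S) r) (C \<times> space Z)"
      unfolding e by (subst emeasure_density) (auto simp: nn_integral_distr)
    also have "\<dots> = emeasure (density M s) C"
      unfolding dr p ds using CZ
      by (auto simp: emeasure_distr sm intro!: arg_cong[where f = "emeasure M"])
    finally show "emeasure (density M (\<lambda>u. r (u, S u))) C = emeasure (density M s) C" .
  qed simp
  then show ?thesis
    by (subst (asm) M.density_unique_iff) auto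
qed

section \<open>The marginal chain on \<open>X\<close>\<close>

text \<open>The Dirac mass at \<open>S (q, v)\<close> evaluates \<open>\<alpha>\<close> on the graph
  of \<open>S\<close> only, and the cylinder over \<open>A\<close> sees only first
  coordinates.\<close>

lemma emeasure_marginal_Pbar:
  assumes V: "V \<in> X \<rightarrow>\<^sub>M prob_algebra Y" and S[measurable]: "S \<in> X \<Otimes>\<^sub>M Y \<rightarrow>\<^sub>M X \<Otimes>\<^sub>M Y"
    and \<alpha>[measurable]: "\<alpha> \<in> borel_measurable ((X \<Otimes>\<^sub>M Y) \<Otimes>\<^sub>M (X \<Otimes>\<^sub>M Y))" and le: "\<And>z. \<alpha> z \<le> 1"
    and q: "q \<in> space X" and A[measurable]: "A \<in> sets X"
  shows "emeasure (marginal_kernel X Y V (Pbar (X \<Otimes>\<^sub>M Y) S \<alpha>) q) A =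
    (\<integral>\<^sup>+ v. \<alpha> ((q, v), S (q, v)) * indicator A (fst (S (q, v)))
      + indicator A q * (1 - \<alpha> ((q, v), S (q, v))) \<partial>V q)"
proof -
  have Vq: "sets (V q) = sets Y"
    using measurable_space[OF V q] by (auto simp: space_prob_algebra)
  show ?thesis
    unfolding emeasure_marginal_kernel[OF V Pbar_markov_kernel[OF S \<alpha> le] q A]
  proof (rule nn_integral_cong)
    fix v assume "v \<in> space (V q)"
    then have v: "v \<in> space Y" using sets_eq_imp_space_eq[OF Vq] by simp
    then have qv[simp]: "(q, v) \<in> space (X \<Otimes>\<^sub>M Y)" using q by (simp add: space_pair_measure)
    have Sqv[simp]: "S (q, v) \<in> space (X \<Otimes>\<^sub>M Y)" using measurable_space[OF S qv] .
    then have [simp]: "snd (S (q, v)) \<in> space Y" by (auto simp: space_pair_measure)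
    show "emeasure (Pbar (X \<Otimes>\<^sub>M Y) S \<alpha> (q, v)) (A \<times> space Y) =
      \<alpha> ((q, v), S (q, v)) * indicator A (fst (S (q, v))) + indicator A q * (1 - \<alpha> ((q, v), S (q, v)))"
      using v by (simp add: emeasure_Pbar emeasure_density nn_integral_return indicator_times)
  qed
qed

text \<open>The functions \<open>r\<close> and \<open>s\<close> are arbitrary versions of the two
  derivatives, chosen independently, so the result does not depend on the choice.\<close>

theorem corollary3p7:
  fixes X :: "'q measure" and Y :: "'v measure" and \<mu> :: "'q measure"
    and V :: "'q \<Rightarrow> 'v measure" and S :: "'q \<times> 'v \<Rightarrow> 'q \<times> 'v"
    and r :: "('q \<times> 'v) \<times> ('q \<times> 'v) \<Rightarrow> ennreal" and s :: "'q \<times> 'v \<Rightarrow> ennreal"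
  defines "Z \<equiv> X \<Otimes>\<^sub>M Y"
  defines "M \<equiv> semidirect X Y \<mu> V"
  defines "\<alpha> \<equiv> (\<lambda>z. min 1 (r z))"
  defines "\<alpha>hat \<equiv> (\<lambda>z. min 1 (s z))"
  defines "P \<equiv> marginal_kernel X Y V (Pbar Z S \<alpha>)"
  assumes mu: "\<mu> \<in> space (prob_algebra X)"
    and V: "V \<in> X \<rightarrow>\<^sub>M prob_algebra Y"
    and S: "S \<in> Z \<rightarrow>\<^sub>M Z"
    and S_involution: "\<forall>u\<in>space Z. S (S u) = u"
    and S_abs_cont: "absolutely_continuous M (distr M Z S)"
    and r: "RN_version (eta Z M S) (eta_perp Z M S) r"
    and s: "RN_version M (distr M Z S) s"
  shows "detailed_balance X \<mu> P \<and>
    (AE q in \<mu>. \<forall>A\<in>sets X. emeasure (P q) A =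
      (\<integral>\<^sup>+ v. \<alpha>hat (q, v) * emeasure (return X (fst (S (q, v)))) A \<partial>V q)
      + emeasure (return X q) A * (\<integral>\<^sup>+ v. (1 - \<alpha>hat (q, v)) \<partial>V q))"
proof -
  have Mp: "M \<in> space (prob_algebra Z)"
    unfolding M_def Z_def by (rule semidirect_prob_algebra[OF mu V])
  have Msets[measurable_cong]: "sets M = sets Z" and "prob_space M"
    using Mp by (auto simp: space_prob_algebra)
  then interpret M: prob_space M by simp
  have ms[measurable_cong]: "sets \<mu> = sets X"
    using mu by (auto simp: space_prob_algebra)
  have sm: "space \<mu> = space X" using ms by (rule sets_eq_imp_space_eq)
  note S[unfolded Z_def, measurable]
  have inv: "S (S u) = u" if "u \<in> space Z" for u using S_involution that by blast
  have rm[measurable]: "r \<in> borel_measurable ((X \<Otimes>\<^sub>M Y) \<Otimes>\<^sub>M (X \<Otimes>\<^sub>M Y))"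
    using r sets_eta[OF Mp S] by (simp add: RN_version_def Z_def cong: measurable_cong_sets)
  have sZ: "s \<in> borel_measurable Z"
    using s Msets by (simp add: RN_version_def cong: measurable_cong_sets)
  note sZ[unfolded Z_def, measurable]
  have \<alpha>m[measurable]: "\<alpha> \<in> borel_measurable ((X \<Otimes>\<^sub>M Y) \<Otimes>\<^sub>M (X \<Otimes>\<^sub>M Y))" and \<alpha>le: "\<alpha> z \<le> 1" for z
    by (simp_all add: \<alpha>_def)
  have \<alpha>hat[measurable]: "\<alpha>hat \<in> borel_measurable (X \<Otimes>\<^sub>M Y)"
    by (simp add: \<alpha>hat_def)
  have ds: "density M s = distr M Z S"
    by (rule RN_version_density[OF M.sigma_finite_measure_axioms S_abs_cont _ s]) (simp add: Msets)
  have PK: "P \<in> X \<rightarrow>\<^sub>M prob_algebra X"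
    unfolding P_def Z_def
    by (rule marginal_kernel_markov_kernel[OF V Pbar_markov_kernel[OF S[unfolded Z_def] \<alpha>m \<alpha>le]])

  have "AE u in M. r (u, S u) = s u"
    by (rule RN_deriv_eta_on_graph[OF Mp S inv S_abs_cont r s])
  then have "AE u in M. \<alpha> (u, S u) = \<alpha>hat u"
    by eventually_elim (simp add: \<alpha>_def \<alpha>hat_def)
  then have "AE q in \<mu>. AE v in V q. \<alpha> ((q, v), S (q, v)) = \<alpha>hat (q, v)"
    unfolding M_def by (rule AE_semidirect[OF mu V])
  \<comment> \<open>The exceptional set of \<open>q\<close> comes from the agreement of
    \<open>\<alpha>\<close> and \<open>\<alpha>hat\<close> and is the same for every
    \<open>A\<close>, so the quantifier over \<open>A\<close> stays inside
    \<open>AE\<close>.\<close>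
  then have P_eq: "AE q in \<mu>. \<forall>A\<in>sets X. emeasure (P q) A =
      (\<integral>\<^sup>+ v. \<alpha>hat (q, v) * indicator A (fst (S (q, v))) + indicator A q * (1 - \<alpha>hat (q, v)) \<partial>V q)"
  proof (rule AE_mp, intro AE_I2 impI ballI)
    fix q A assume "q \<in> space \<mu>" and [measurable]: "A \<in> sets X"
      and ae: "AE v in V q. \<alpha> ((q, v), S (q, v)) = \<alpha>hat (q, v)"
    then have q: "q \<in> space X" by (simp add: sm)
    show "emeasure (P q) A =
      (\<integral>\<^sup>+ v. \<alpha>hat (q, v) * indicator A (fst (S (q, v))) + indicator A q * (1 - \<alpha>hat (q, v)) \<partial>V q)"
      unfolding P_def Z_def emeasure_marginal_Pbar[OF V S[unfolded Z_def] \<alpha>m \<alpha>le q \<open>A \<in> sets X\<close>]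
      by (rule nn_integral_cong_AE) (use ae in eventually_elim, simp)
  qed

  \<comment> \<open>The first integral collects the accepted moves and the second the rejections. A
    rejection stays at \<open>q\<close>, so the second integral is already symmetric in
    \<open>A\<close> and \<open>B\<close>.\<close>
  have rect: "emeasure (semidirect X X \<mu> P) (A \<times> B) =
      (\<integral>\<^sup>+ u. \<alpha>hat u * (indicator A (fst u) * indicator B (fst (S u))) \<partial>M)
      + (\<integral>\<^sup>+ u. indicator A (fst u) * indicator B (fst u) * (1 - \<alpha>hat u) \<partial>M)"
    if A[measurable]: "A \<in> sets X" and B[measurable]: "B \<in> sets X" for A B
  proof -
    have "emeasure (semidirect X X \<mu> P) (A \<times> B) = (\<integral>\<^sup>+ q. indicator A q * emeasure (P q) B \<partial>\<mu>)"
    proof (subst emeasure_semidirect[OF mu PK])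
      show "(\<integral>\<^sup>+ x. \<integral>\<^sup>+ y. indicator (A \<times> B) (x, y) \<partial>P x \<partial>\<mu>) = (\<integral>\<^sup>+ q. indicator A q * emeasure (P q) B \<partial>\<mu>)"
        by (intro nn_integral_cong) (simp add: indicator_times nn_integral_cmult_indicator P_def)
    qed simp
    also have "\<dots> = (\<integral>\<^sup>+ q. \<integral>\<^sup>+ v. \<alpha>hat (q, v) * (indicator A q * indicator B (fst (S (q, v))))
        + indicator A q * indicator B q * (1 - \<alpha>hat (q, v)) \<partial>V q \<partial>\<mu>)"
    proof (rule nn_integral_cong_AE)
      show "AE q in \<mu>. indicator A q * emeasure (P q) B =
        (\<integral>\<^sup>+ v. \<alpha>hat (q, v) * (indicator A q * indicator B (fst (S (q, v))))
          + indicator A q * indicator B q * (1 - \<alpha>hat (q, v)) \<partial>V q)"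
        using P_eq by eventually_elim (auto simp: B indicator_def[of A])
    qed
    also have "\<dots> = (\<integral>\<^sup>+ u. \<alpha>hat u * (indicator A (fst u) * indicator B (fst (S u)))
        + indicator A (fst u) * indicator B (fst u) * (1 - \<alpha>hat u) \<partial>M)"
      unfolding M_def by (subst nn_integral_semidirect[OF mu V]) auto
    also have "\<dots> = (\<integral>\<^sup>+ u. \<alpha>hat u * (indicator A (fst u) * indicator B (fst (S u))) \<partial>M)
      + (\<integral>\<^sup>+ u. indicator A (fst u) * indicator B (fst u) * (1 - \<alpha>hat u) \<partial>M)"
      by (rule nn_integral_add; simp only: measurable_cong_sets[OF Msets[unfolded Z_def] refl]; measurable)
    finally show ?thesis .
  qed

  have symm: "emeasure (semidirect X X \<mu> P) (A \<times> B) = emeasure (semidirect X X \<mu> P) (B \<times> A)"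
    if A[measurable]: "A \<in> sets X" and B[measurable]: "B \<in> sets X" for A B
  proof -
    \<comment> \<open>Composing this test function with \<open>S\<close> exchanges its base points
      \<open>u\<close> and \<open>S u\<close>, so invariance of the accepted part under
      \<open>S\<close> interchanges \<open>A\<close> and \<open>B\<close>.\<close>
    have "(\<lambda>u. indicator B (fst u) * indicator A (fst (S u)) :: ennreal) \<in> borel_measurable Z"
      unfolding Z_def by measurable
    from involution_acceptance_symmetric[OF M.finite_measure_axioms Msets S inv sZ ds this]
    have "(\<integral>\<^sup>+ u. \<alpha>hat u * (indicator B (fst (S u)) * indicator A (fst (S (S u)))) \<partial>M) =
      (\<integral>\<^sup>+ u. \<alpha>hat u * (indicator B (fst u) * indicator A (fst (S u))) \<partial>M)"
      by (simp add: \<alpha>hat_def)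
    moreover have "(\<integral>\<^sup>+ u. \<alpha>hat u * (indicator B (fst (S u)) * indicator A (fst (S (S u)))) \<partial>M) =
      (\<integral>\<^sup>+ u. \<alpha>hat u * (indicator A (fst u) * indicator B (fst (S u))) \<partial>M)"
      by (intro nn_integral_cong) (simp add: inv sets_eq_imp_space_eq[OF Msets] mult.commute)
    ultimately show ?thesis
      by (simp add: rect A B mult.commute[of "indicator A _" "indicator B _"])
  qed

  have D: "semidirect X X \<mu> P \<in> space (prob_algebra (X \<Otimes>\<^sub>M X))"
    by (rule semidirect_prob_algebra[OF mu PK])
  then have Dsets[measurable_cong]: "sets (semidirect X X \<mu> P) = sets (X \<Otimes>\<^sub>M X)"
    and Dprob: "prob_space (semidirect X X \<mu> P)"
    by (auto simp: space_prob_algebra)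
  have "detailed_balance X \<mu> P"
    unfolding detailed_balance_def
  proof (rule measure_eqI_rectangles[OF prob_space.finite_measure[OF Dprob] Dsets])
    fix A B assume A[measurable]: "A \<in> sets X" and B[measurable]: "B \<in> sets X"
    have "(\<lambda>(x, y). (y, x)) -` (A \<times> B) \<inter> space (semidirect X X \<mu> P) = B \<times> A"
      using sets.sets_into_space[OF A] sets.sets_into_space[OF B]
      by (auto simp: sets_eq_imp_space_eq[OF Dsets] space_pair_measure)
    then have "emeasure (swap_measure X (semidirect X X \<mu> P)) (A \<times> B) = emeasure (semidirect X X \<mu> P) (B \<times> A)"
      unfolding swap_measure_def by (subst emeasure_distr) auto
    then show "emeasure (semidirect X X \<mu> P) (A \<times> B) = emeasure (swap_measure X (semidirect X X \<mu> P)) (A \<times> B)"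
      using symm[OF A B] by simp
  qed (simp add: swap_measure_def)
  \<comment> \<open>This is \<open>P_eq\<close> split by linearity: a Dirac mass evaluated at
    \<open>A\<close> is an indicator, and \<open>indicator A q\<close> is constant in
    \<open>v\<close>.\<close>
  moreover have "AE q in \<mu>. \<forall>A\<in>sets X. emeasure (P q) A =
      (\<integral>\<^sup>+ v. \<alpha>hat (q, v) * emeasure (return X (fst (S (q, v)))) A \<partial>V q)
      + emeasure (return X q) A * (\<integral>\<^sup>+ v. (1 - \<alpha>hat (q, v)) \<partial>V q)"
    using P_eq
  proof (rule AE_mp, intro AE_I2 impI ballI)
    fix q A assume "q \<in> space \<mu>" and A[measurable]: "A \<in> sets X"
      and eq: "\<forall>A\<in>sets X. emeasure (P q) A =
        (\<integral>\<^sup>+ v. \<alpha>hat (q, v) * indicator A (fst (S (q, v))) + indicator A q * (1 - \<alpha>hat (q, v)) \<partial>V q)"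
    then have q[simp]: "q \<in> space X" by (simp add: sm)
    have Vq[measurable_cong]: "sets (V q) = sets Y"
      using measurable_space[OF V q] by (auto simp: space_prob_algebra)
    show "emeasure (P q) A = (\<integral>\<^sup>+ v. \<alpha>hat (q, v) * emeasure (return X (fst (S (q, v)))) A \<partial>V q)
      + emeasure (return X q) A * (\<integral>\<^sup>+ v. (1 - \<alpha>hat (q, v)) \<partial>V q)"
      using eq A by (simp add: nn_integral_add nn_integral_cmult)
  qed
  ultimately show ?thesis ..
qed

end
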